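(* For all integers $n\ge 1$ and $k\ge 1$, $\chi_{la}\big((2k+1)P_2 \vee O_{2n+1}\big) = 3$.
   Context: For a graph $G$ with $q$ edges, a bijection $f:E(G)\to\{1,2,\dots,q\}$ is a local antimagic labeling if $f^+(u)\neq f^+(v)$ for every edge $uv$, where $f^+(u)$ is the sum of $f(e)$ over all edges $e$ incident to $u$. The local antimagic chromatic number $\chi_{la}(G)$ is the minimum, over all local antimagic labelings $f$ of $G$, of the number of distinct values of $f^+$. $O_m$ denotes the null graph on $m$ vertices, $aP_2$ the disjoint union of $a$ copies of $P_2$ (a single edge), and $G\vee H$ the join of $G$ and $H$. *)

theory Defs
  imports Main
begin

record 'a graph =
  verts :: "'a set"
  edges :: "'a set set"

definition finite_simple_graph :: "'a graph \<Rightarrow> bool" where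
  "finite_simple_graph G \<longleftrightarrow> finite (verts G) \<and> (\<forall>e \<in> edges G. e \<subseteq> verts G \<and> card e = 2)"

definition null_graph :: "nat \<Rightarrow> nat graph" where
  "null_graph m = \<lparr>verts = {..<m}, edges = {}\<rparr>"

definition path_graph :: "nat \<Rightarrow> nat graph" where
  "path_graph n = \<lparr>verts = {..<n}, edges = {{i, Suc i} |i. Suc i < n}\<rparr>"

definition graph_copies :: "nat \<Rightarrow> 'a graph \<Rightarrow> (nat \<times> 'a) graph" where
  "graph_copies a G = \<lparr>verts = {..<a} \<times> verts G,
                       edges = {Pair i ` e |i e. i < a \<and> e \<in> edges G}\<rparr>"

definition graph_join :: "'a graph \<Rightarrow> 'b graph \<Rightarrow> ('a + 'b) graph" where
  "graph_join G H = \<lparr>verts = verts G <+> verts H,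
                     edges = (`) Inl ` edges G \<union> (`) Inr ` edges H
                             \<union> {{Inl u, Inr v} |u v. u \<in> verts G \<and> v \<in> verts H}\<rparr>"

definition vertex_sum :: "'a graph \<Rightarrow> ('a set \<Rightarrow> nat) \<Rightarrow> 'a \<Rightarrow> nat" where
  "vertex_sum G f u = (\<Sum>e \<in> {e \<in> edges G. u \<in> e}. f e)"

definition local_antimagic_labeling :: "'a graph \<Rightarrow> ('a set \<Rightarrow> nat) \<Rightarrow> bool" where
  "local_antimagic_labeling G f \<longleftrightarrow>
     bij_betw f (edges G) {1..card (edges G)} \<and>
     (\<forall>u v. {u, v} \<in> edges G \<longrightarrow> vertex_sum G f u \<noteq> vertex_sum G f v)"

text \<open>
  On \<^typ>\<open>nat\<close>, \<^const>\<open>Inf\<close> of a nonempty set is its minimum. A graph without any local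
  antimagic labeling gets the value 0, so a positive value entails that a labeling exists.
\<close>

definition chi_la :: "'a graph \<Rightarrow> nat" where
  "chi_la G = Inf {card (vertex_sum G f ` verts G) |f. local_antimagic_labeling G f}"

lemma path_graph_2: "path_graph 2 = \<lparr>verts = {0, 1}, edges = {{0, 1}}\<rparr>"
  by (auto simp: path_graph_def less_2_cases_iff)

lemma finite_simple_null_graph: "finite_simple_graph (null_graph m)"
  by (simp add: finite_simple_graph_def null_graph_def)

lemma finite_simple_path_graph: "finite_simple_graph (path_graph n)"
  by (auto simp: finite_simple_graph_def path_graph_def)

lemma finite_simple_graph_copies:
  assumes "finite_simple_graph G"
  shows "finite_simple_graph (graph_copies a G)"
  using assms by (fastforce simp: finite_simple_graph_def graph_copies_def card_image inj_on_def)

lemma finite_simple_graph_join: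
  assumes "finite_simple_graph G" "finite_simple_graph H"
  shows "finite_simple_graph (graph_join G H)"
  using assms by (fastforce simp: finite_simple_graph_def graph_join_def card_image inj_on_def)

end

theory Submission
  imports Defs
begin

text \<open>
  Let \<open>a\<close> be the number of copies of \<open>P\<^sub>2\<close> and \<open>m = 2n + 1\<close>. Put the labels into a grid with \<open>a\<close>
  columns and \<open>2m + 1\<close> rows, filled row by row in boustrophedon order. Column \<open>c\<close> belongs to
  the copy \<open>u\<^sub>c v\<^sub>c\<close>: the middle row \<open>m\<close> labels \<open>u\<^sub>c v\<^sub>c\<close>, a row \<open>r < m\<close> labels \<open>u\<^sub>c w\<^sub>r\<close>, and its
  mirror row \<open>2m - r\<close> labels \<open>v\<^sub>c w\<^sub>r\<close>. Every \<open>u\<^sub>c\<close> and every \<open>v\<^sub>c\<close> then meets \<open>m + 1\<close> consecutive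
  rows, an even number, and two consecutive entries of a boustrophedon column have a sum
  independent of the column. Every \<open>w\<^sub>r\<close> meets two full rows with fixed index sum. So there are
  three vertex sums; that the third differs from the other two is seen modulo \<open>a\<close>.
  A triangle shows that three values are needed.
\<close>

section \<open>Labelings via an index set, and the lower bound\<close>

text \<open>Lets grid cells stand in for edges: \<open>g\<close> composed with the inverse of
  \<open>E\<close> labels the edges, and reindexing along \<open>E\<close> turns vertex sums into
  sums over cells.\<close>

lemma labeling_of_enumeration:
  assumes E: "bij_betw E I (edges G)" and g: "bij_betw g I {1..card I}"
  obtains f where "bij_betw f (edges G) {1..card (edges G)}"
    and "\<And>u. vertex_sum G f u = (\<Sum>i\<in>{i \<in> I. u \<in> E i}. g i)"
proof
  let ?f = "g \<circ> inv_into I E"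
  have "card I = card (edges G)"
    using E by (rule bij_betw_same_card)
  then show "bij_betw ?f (edges G) {1..card (edges G)}"
    using bij_betw_trans[OF bij_betw_inv_into[OF E] g] by simp
  fix u
  have "inj_on E {i \<in> I. u \<in> E i}"
    using E by (auto simp: bij_betw_def inj_on_def)
  moreover have "{e \<in> edges G. u \<in> e} = E ` {i \<in> I. u \<in> E i}"
    using E by (auto simp: bij_betw_def)
  moreover have "?f (E i) = g i" if "i \<in> I" for i
    using E that by (simp add: bij_betw_inv_into_left)
  ultimately show "vertex_sum G ?f u = (\<Sum>i\<in>{i \<in> I. u \<in> E i}. g i)"
    by (simp add: vertex_sum_def sum.reindex)
qed

lemma chi_la_eqI:
  assumes "local_antimagic_labeling G f" and "card (vertex_sum G f ` verts G) = c"
    and "\<And>f. local_antimagic_labeling G f \<Longrightarrow> c \<le> card (vertex_sum G f ` verts G)"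
  shows "chi_la G = c"
  unfolding chi_la_def using assms by (intro cInf_eq_minimum) auto

lemma triangle_vertex_sums:
  assumes "local_antimagic_labeling G f" and "finite (verts G)" and "{x, y, z} \<subseteq> verts G"
    and "{x, y} \<in> edges G" "{y, z} \<in> edges G" "{x, z} \<in> edges G"
  shows "3 \<le> card (vertex_sum G f ` verts G)"
proof -
  let ?s = "vertex_sum G f"
  have "?s x \<noteq> ?s y" "?s y \<noteq> ?s z" "?s x \<noteq> ?s z"
    using assms by (auto simp: local_antimagic_labeling_def)
  then have "3 = card (?s ` {x, y, z})"
    by simp
  also have "\<dots> \<le> card (?s ` verts G)"
    using assms by (intro card_mono image_mono) auto
  finally show ?thesis .
qed

section \<open>The boustrophedon grid: bijectivity, column and row sums\<close>

definition snake :: "nat \<Rightarrow> nat \<times> nat \<Rightarrow> nat" where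
  "snake a = (\<lambda>(c, r). r * a + (if even r then c + 1 else a - c))"

lemma bij_betw_snake: "bij_betw (snake a) ({..<a} \<times> {..<R}) {1..card ({..<a} \<times> {..<R})}"
proof -
  let ?I = "{..<a} \<times> {..<R}"
  \<comment> \<open>Row \<open>r\<close> fills the block from \<open>r * a + 1\<close> to
    \<open>r * a + a\<close>, so division by \<open>a\<close> recovers it once the labels are
    shifted to start at 0.\<close>
  have row: "r = (snake a (c, r) - 1) div a" if "c < a" for c r
  proof -
    have "snake a (c, r) - 1 = (if even r then c else a - c - 1) + r * a"
      using that by (auto simp: snake_def)
    then show ?thesis
      using that by (simp add: div_mult_self3)
  qed
  have inj: "inj_on (snake a) ?I"
  proof (rule inj_onI, clarsimp)
    fix c r c' r' assume *: "c < a" "c' < a" "snake a (c, r) = snake a (c', r')"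
    then have "r = r'"
      using row[of c r] row[of c' r'] by metis
    with * show "c = c' \<and> r = r'"
      by (auto simp: snake_def split: if_splits)
  qed
  have "snake a ` ?I \<subseteq> {1..card ?I}"
  proof clarsimp
    fix c r assume "c < a" "r < R"
    then have "Suc r * a \<le> R * a"
      by (intro mult_le_mono1) simp
    with \<open>c < a\<close> show "Suc 0 \<le> snake a (c, r) \<and> snake a (c, r) \<le> a * R"
      by (auto simp: snake_def mult.commute)
  qed
  with inj have "snake a ` ?I = {1..card ?I}"
    by (intro card_subset_eq) (auto simp: card_image)
  with inj show ?thesis
    by (simp add: bij_betw_def)
qed

lemma snake_column_sum:
  assumes "c < a"
  shows "(\<Sum>r = s..<s + 2 * N. snake a (c, r)) = N * (2 * a * (s + N) + 1)"
proof (induction N)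
  case (Suc N)
  \<comment> \<open>Of two adjacent rows one ascends and one descends, so \<open>c\<close>
    cancels.\<close>
  have pair: "snake a (c, r) + snake a (c, Suc r) = 2 * a * (r + 1) + 1" for r
    using assms by (simp add: snake_def algebra_simps)
  have "(\<Sum>r = s..<s + 2 * Suc N. snake a (c, r)) =
      (\<Sum>r = s..<s + 2 * N. snake a (c, r)) +
      (snake a (c, s + 2 * N) + snake a (c, Suc (s + 2 * N)))"
    by simp
  also have "\<dots> = Suc N * (2 * a * (s + Suc N) + 1)"
    unfolding Suc pair by (simp add: algebra_simps)
  finally show ?case .
qed simp

lemma snake_row_sum: "2 * (\<Sum>c<a. snake a (c, r)) = a * (2 * r * a + a + 1)"
proof -
  \<comment> \<open>A descending row is an ascending one reversed.\<close>
  have "(\<Sum>c<a. if even r then c + 1 else a - c) = (\<Sum>c<a. c + 1)"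
  proof (cases "even r")
    case False
    then show ?thesis
      using sum.nat_diff_reindex[of "\<lambda>c. a - c" a] by (auto intro!: sum.cong)
  qed simp
  moreover have "2 * (\<Sum>c<a. c + 1) = a * (a + 1)"
    by (induction a) auto
  ultimately show ?thesis
    by (simp add: snake_def sum.distrib algebra_simps)
qed

section \<open>Grid cells as edges of the join\<close>

text \<open>\<open>Inl (c, 0)\<close>, \<open>Inl (c, 1)\<close> and \<open>Inr j\<close> are the
  vertices \<open>u\<^sub>c\<close>, \<open>v\<^sub>c\<close> and \<open>w\<^sub>j\<close> of the
  overview.\<close>

definition cell_edge :: "nat \<Rightarrow> nat \<times> nat \<Rightarrow> ((nat \<times> nat) + nat) set" where
  "cell_edge m = (\<lambda>(c, r). if r = m then {Inl (c, 0), Inl (c, 1)}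
     else if r < m then {Inl (c, 0), Inr r} else {Inl (c, 1), Inr (2 * m - r)})"

abbreviation (input) matching_join_null :: "nat \<Rightarrow> nat \<Rightarrow> ((nat \<times> nat) + nat) graph" where
  "matching_join_null a m \<equiv> graph_join (graph_copies a (path_graph 2)) (null_graph m)"

lemma verts_matching_join_null:
  "verts (matching_join_null a m) = ({..<a} \<times> {0, 1}) <+> {..<m}"
  by (simp add: graph_join_def graph_copies_def null_graph_def path_graph_2)

lemma edges_matching_join_null:
  "edges (matching_join_null a m) = {{Inl (c, 0), Inl (c, 1)} |c. c < a} \<union>
     {{Inl (c, 0), Inr j} |c j. c < a \<and> j < m} \<union> {{Inl (c, 1), Inr j} |c j. c < a \<and> j < m}"
  by (auto simp: graph_join_def graph_copies_def null_graph_def path_graph_2 image_iff) blast+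

lemma bij_betw_cell_edge:
  "bij_betw (cell_edge m) ({..<a} \<times> {..<2 * m + 1}) (edges (matching_join_null a m))"
proof (rule bij_betw_imageI)
  show "inj_on (cell_edge m) ({..<a} \<times> {..<2 * m + 1})"
    by (auto simp: inj_on_def cell_edge_def doubleton_eq_iff split: if_splits)
  \<comment> \<open>Rows beyond \<open>m\<close> are parametrized by their mirror row
    \<open>j\<close>, so that each equation matches one family of edges.\<close>
  have eqs: "cell_edge m (c, m) = {Inl (c, 0), Inl (c, 1)}"
    "j < m \<Longrightarrow> cell_edge m (c, j) = {Inl (c, 0), Inr j}"
    "j < m \<Longrightarrow> cell_edge m (c, 2 * m - j) = {Inl (c, 1), Inr j}" for c j
    by (auto simp: cell_edge_def)
  show "cell_edge m ` ({..<a} \<times> {..<2 * m + 1}) = edges (matching_join_null a m)"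
  proof (intro equalityI subsetI)
    fix e assume "e \<in> cell_edge m ` ({..<a} \<times> {..<2 * m + 1})"
    then obtain c r where e: "e = cell_edge m (c, r)" "c < a" "r < 2 * m + 1"
      by auto
    consider "r = m" | "r < m" | j where "j < m" "r = 2 * m - j"
    proof (cases "r > m")
      case True
      with e(3) have "2 * m - r < m" "r = 2 * m - (2 * m - r)"
        by auto
      then show ?thesis
        by (rule that(3))
    qed (use that in linarith)
    then show "e \<in> edges (matching_join_null a m)"
      unfolding edges_matching_join_null using e(1,2) by cases (simp_all add: eqs, blast+)
  next
    fix e assume "e \<in> edges (matching_join_null a m)"
    then obtain c r where "c < a" "r \<le> 2 * m" "e = cell_edge m (c, r)"
    proof (unfold edges_matching_join_null, elim UnE CollectE exE conjE)
      fix c assume "c < a" "e = {Inl (c, 0), Inl (c, 1)}"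
      then show ?thesis
        by (intro that[of c m]) (simp_all add: eqs)
    next
      fix c j assume "c < a" "j < m" "e = {Inl (c, 0), Inr j}"
      then show ?thesis
        by (intro that[of c j]) (simp_all add: eqs)
    next
      fix c j assume "c < a" "j < m" "e = {Inl (c, 1), Inr j}"
      then show ?thesis
        by (intro that[of c "2 * m - j"]) (simp_all add: eqs)
    qed
    then show "e \<in> cell_edge m ` ({..<a} \<times> {..<2 * m + 1})"
      by (intro image_eqI[of _ _ "(c, r)"]) auto
  qed
qed

text \<open>The middle row is shared by both ends of its edge, so each end sees a run of
  \<open>m + 1\<close> rows, starting at 0 or at \<open>m\<close>; these starts are the
  \<open>s\<close> of \<open>snake_column_sum\<close>.\<close>

lemma cells_at_vertex:
  fixes m a :: nat
  defines "I \<equiv> {..<a} \<times> {..<2 * m + 1}"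
  shows "c < a \<Longrightarrow> {i \<in> I. Inl (c, 0) \<in> cell_edge m i} = {c} \<times> {0..<m + 1}"
    and "c < a \<Longrightarrow> {i \<in> I. Inl (c, 1) \<in> cell_edge m i} = {c} \<times> {m..<m + (m + 1)}"
    and "j < m \<Longrightarrow> {i \<in> I. Inr j \<in> cell_edge m i} = {..<a} \<times> {j, 2 * m - j}"
  by (auto simp: I_def cell_edge_def split: if_splits)

section \<open>The third vertex sum differs from the other two\<close>

lemma snake_sums_distinct:
  fixes a n :: nat
  assumes "a \<ge> 1"
  defines "T \<equiv> a * (2 * (2 * n + 1) * a + a + 1)"
  shows "(n + 1) * (2 * a * (n + 1) + 1) \<noteq> T"
    and "(n + 1) * (2 * a * (3 * n + 2) + 1) \<noteq> T"
proof -
  \<comment> \<open>Both column sums have this form, with \<open>x = n + 1\<close> or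
    \<open>x = 3 * n + 2\<close>. Modulo \<open>a\<close> the left side is \<open>n + 1\<close> and
    \<open>T\<close> is 0, hence \<open>n + 1 = q * a\<close>; cancelling \<open>a\<close> leaves
    the stated identity.\<close>
  have quot: "\<exists>q\<ge>1. n + 1 = q * a \<and> q * (2 * a * x + 1) + a = 4 * q * a * a + 1"
    if eq: "(n + 1) * (2 * a * x + 1) = T" for x
  proof -
    have "a dvd (n + 1) * (2 * a * x) + (n + 1)"
      using eq by (simp add: T_def algebra_simps)
    then have "a dvd n + 1"
      by (metis dvd_add_right_iff dvd_mult dvd_mult2 dvd_triv_right)
    then obtain q where q: "n + 1 = q * a"
      by (metis dvdE mult.commute)
    then have "q \<ge> 1"
      by (cases q) auto
    have "a * (q * (2 * a * x + 1)) = a * (2 * (2 * n + 1) * a + a + 1)"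
      using eq unfolding T_def q by (simp only: ac_simps)
    then have "q * (2 * a * x + 1) = 2 * (2 * n + 1) * a + a + 1"
      using \<open>a \<ge> 1\<close> by (simp only: mult_cancel1) simp
    then have "q * (2 * a * x + 1) + a = 4 * (n + 1) * a + 1"
      by (simp add: algebra_simps)
    then show ?thesis
      using q \<open>q \<ge> 1\<close> by auto
  qed
  have aa: "a \<le> a * a"
    using \<open>a \<ge> 1\<close> by simp
  show "(n + 1) * (2 * a * (n + 1) + 1) \<noteq> T"
  proof
    assume "(n + 1) * (2 * a * (n + 1) + 1) = T"
    then obtain q where q: "q \<ge> 1" "q * (2 * a * (q * a) + 1) + a = 4 * q * a * a + 1"
      using quot by metis
    \<comment> \<open>Here \<open>x = q * a\<close>, so 2 q^2 a^2 + q + a = 4 q a^2 + 1. For q = 1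
      this says a = 2 a^2; for q \<ge> 2 the left side is larger, as q + a > 1.\<close>
    show False
    proof (cases "q = 1")
      case True
      with q aa \<open>a \<ge> 1\<close> show False
        by (simp add: algebra_simps)
    next
      case False
      with q have "2 * (2 * (q * a * a)) \<le> q * (2 * (q * a * a))"
        by (intro mult_le_mono1) simp
      moreover have "q * (2 * (q * a * a)) + q + a = 2 * (2 * (q * a * a)) + 1"
        using q(2) by (simp add: algebra_simps)
      ultimately show False
        using q(1) False \<open>a \<ge> 1\<close> by linarith
    qed
  qed
  show "(n + 1) * (2 * a * (3 * n + 2) + 1) \<noteq> T"
  proof
    assume "(n + 1) * (2 * a * (3 * n + 2) + 1) = T"
    then obtain q where q: "q \<ge> 1" "n + 1 = q * a"
        "q * (2 * a * (3 * n + 2) + 1) + a = 4 * q * a * a + 1"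
      using quot by metis
    \<comment> \<open>Bounding \<open>x\<close> below by \<open>2 * q * a\<close> gives 4 q^2 a^2 +
      q + a \<le> 4 q a^2 + 1, impossible since q and a are positive.\<close>
    have "2 * (n + 1) \<le> 3 * n + 2"
      by simp
    then have "q * (2 * a * (2 * (q * a)) + 1) + a \<le> q * (2 * a * (3 * n + 2) + 1) + a"
      unfolding q(2) by (intro add_mono mult_le_mono) auto
    then have "4 * (q * (q * a * a)) + q + a \<le> 4 * (q * a * a) + 1"
      using q(3) by (simp add: algebra_simps)
    moreover have "1 * (q * a * a) \<le> q * (q * a * a)"
      using q(1) by (intro mult_le_mono1)
    ultimately show False
      using q(1) \<open>a \<ge> 1\<close> by linarith
  qed
qed

section \<open>The labeling and its three sums\<close>

theorem chi_la_matching_join_null_odd: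
  assumes "a \<ge> 1"
  shows "chi_la (matching_join_null a (2 * n + 1)) = 3"
proof -
  define m where "m = 2 * n + 1"
  define G where "G = matching_join_null a m"
  \<comment> \<open>\<open>A\<close>, \<open>B\<close> and \<open>T\<close> are the sums at the
    \<open>u\<^sub>c\<close>, the \<open>v\<^sub>c\<close> and the \<open>w\<^sub>j\<close>. In
    \<open>B\<close>, \<open>3 * n + 2\<close> is \<open>m + (n + 1)\<close>.\<close>
  define A where "A = (n + 1) * (2 * a * (n + 1) + 1)"
  define B where "B = (n + 1) * (2 * a * (3 * n + 2) + 1)"
  define T where "T = a * (2 * m * a + a + 1)"
  have V: "verts G = ({..<a} \<times> {0, 1}) <+> {..<m}"
    by (simp add: G_def verts_matching_join_null)
  have Ed: "edges G = {{Inl (c, 0), Inl (c, 1)} |c. c < a} \<union>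
     {{Inl (c, 0), Inr j} |c j. c < a \<and> j < m} \<union> {{Inl (c, 1), Inr j} |c j. c < a \<and> j < m}"
    by (simp add: G_def edges_matching_join_null)
  obtain f where f: "bij_betw f (edges G) {1..card (edges G)}"
    and sums: "\<And>u. vertex_sum G f u =
      (\<Sum>i\<in>{i \<in> {..<a} \<times> {..<2 * m + 1}. u \<in> cell_edge m i}. snake a i)"
    using labeling_of_enumeration[OF bij_betw_cell_edge[of m a, folded G_def] bij_betw_snake] by blast
  have box: "sum (snake a) (X \<times> Y) = (\<Sum>c\<in>X. \<Sum>r\<in>Y. snake a (c, r))" for X Y
    by (simp add: sum.cartesian_product)
  have rows: "m + 1 = 2 * (n + 1)"
    by (simp add: m_def)
  have sum_u: "vertex_sum G f (Inl (c, 0)) = A" if "c < a" for c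
  proof -
    have "vertex_sum G f (Inl (c, 0)) = (\<Sum>r = 0..<0 + 2 * (n + 1). snake a (c, r))"
      unfolding sums cells_at_vertex(1)[OF that] box rows by simp
    then show ?thesis
      unfolding snake_column_sum[OF that] by (simp add: A_def)
  qed
  have sum_v: "vertex_sum G f (Inl (c, 1)) = B" if "c < a" for c
  proof -
    have "vertex_sum G f (Inl (c, 1)) = (\<Sum>r = m..<m + 2 * (n + 1). snake a (c, r))"
      unfolding sums cells_at_vertex(2)[OF that] box rows by simp
    then show ?thesis
      unfolding snake_column_sum[OF that] by (simp add: B_def m_def)
  qed
  have sum_w: "vertex_sum G f (Inr j) = T" if "j < m" for j
  proof -
    \<comment> \<open>Rows \<open>j\<close> and \<open>2 * m - j\<close> are distinct as
      \<open>j < m\<close>, and their indices add up to \<open>2 * m\<close>, so \<open>j\<close>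
      drops out.\<close>
    have "2 * vertex_sum G f (Inr j) =
        2 * (\<Sum>c<a. snake a (c, j)) + 2 * (\<Sum>c<a. snake a (c, 2 * m - j))"
      unfolding sums cells_at_vertex(3)[OF that] box using that by (simp add: sum.distrib)
    also have "\<dots> = a * (2 * (j + (2 * m - j)) * a + 2 * (a + 1))"
      unfolding snake_row_sum by (simp only: algebra_simps)
    also have "\<dots> = 2 * T"
      using that by (simp add: T_def algebra_simps)
    finally show ?thesis
      by simp
  qed
  have "A \<noteq> T" "B \<noteq> T"
    using snake_sums_distinct[OF assms] unfolding A_def B_def T_def m_def by auto
  moreover have "A < B"
    unfolding A_def B_def using assms by (intro mult_strict_left_mono) auto
  ultimately have distinct: "A \<noteq> B" "A \<noteq> T" "B \<noteq> T"
    by auto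
  have loc: "local_antimagic_labeling G f"
    unfolding local_antimagic_labeling_def
  proof (intro conjI f allI impI)
    \<comment> \<open>Every edge joins two different classes among the \<open>u\<^sub>c\<close>,
      \<open>v\<^sub>c\<close> and \<open>w\<^sub>j\<close>.\<close>
    fix u v assume "{u, v} \<in> edges G"
    then show "vertex_sum G f u \<noteq> vertex_sum G f v"
      unfolding Ed using sum_u sum_v sum_w distinct
      by (auto simp: doubleton_eq_iff)
  qed
  have "vertex_sum G f ` verts G = {A, B, T}"
  proof
    show "vertex_sum G f ` verts G \<subseteq> {A, B, T}"
      unfolding V using sum_u sum_v sum_w by auto
    have "{Inl (0, 0), Inl (0, 1), Inr 0} \<subseteq> verts G"
      using assms by (auto simp: V m_def)
    then show "{A, B, T} \<subseteq> vertex_sum G f ` verts G"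
      using sum_u[of 0] sum_v[of 0] sum_w[of 0] assms by (auto simp: m_def image_iff)
  qed
  with distinct have three: "card (vertex_sum G f ` verts G) = 3"
    by simp
  have pos: "0 < a" "0 < m"
    using assms by (simp_all add: m_def)
  \<comment> \<open>The triangle is \<open>u\<^sub>0\<close>, \<open>v\<^sub>0\<close>,
    \<open>w\<^sub>0\<close>.\<close>
  have "3 \<le> card (vertex_sum G h ` verts G)" if "local_antimagic_labeling G h" for h
  proof (rule triangle_vertex_sums[OF that])
    show "finite (verts G)" "{Inl (0, 0), Inl (0, 1), Inr 0} \<subseteq> verts G"
      using assms by (auto simp: V m_def)
    show "{Inl (0, 0), Inl (0, 1)} \<in> edges G" "{Inl (0, 1), Inr 0} \<in> edges G"
      "{Inl (0, 0), Inr 0} \<in> edges G"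
      unfolding Ed using pos by blast+
  qed
  with loc three show ?thesis
    unfolding G_def m_def by (intro chi_la_eqI)
qed

theorem theorem3p1:
  fixes n k :: nat
  assumes "n \<ge> 1" and "k \<ge> 1"
  shows "chi_la (graph_join (graph_copies (2 * k + 1) (path_graph 2)) (null_graph (2 * n + 1))) = 3"
  by (rule chi_la_matching_join_null_odd) simp

end
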